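(* For any $A, B \in \mathbb{P}_{2}$ with determinant $1$, $$A \#_{t} B = L_{1-t}(\lambda) A + L_{t}(\lambda) B, \quad t \in [0,1],$$ where $\lambda$ is an eigenvalue of $A B^{-1}$.
   Context: $\mathbb{P}_{2}$ is the set of $2 \times 2$ positive definite Hermitian complex matrices. $A \#_{t} B := A^{1/2} (A^{-1/2} B A^{-1/2})^{t} A^{1/2}$ is the weighted geometric mean. For $t \in [0,1]$ the function $L_t : (0,\infty) \to \mathbb{R}$ is defined by $L_t(x) = \dfrac{x^{t} - x^{-t}}{x - x^{-1}}$ for $x \neq 1$ and $L_t(1) = t$ (this is $L_f(x) = \frac{f(x) - f(x^{-1})}{x - x^{-1}}$ for $x \ne 1$, $L_f(1) = f'(1)$, with $f(x) = x^t$). *)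

theory Defs
  imports "HOL-Analysis.Analysis"
begin

definition adjoint_mat :: "complex^'n^'m \<Rightarrow> complex^'m^'n" where
  "adjoint_mat A = (\<chi> i j. cnj (A $ j $ i))"

definition hermitian_mat :: "complex^'n^'n \<Rightarrow> bool" where
  "hermitian_mat A \<longleftrightarrow> adjoint_mat A = A"

definition unitary_mat :: "complex^'n^'n \<Rightarrow> bool" where
  "unitary_mat U \<longleftrightarrow> adjoint_mat U ** U = mat 1 \<and> U ** adjoint_mat U = mat 1"

text \<open>The quadratic form of a Hermitian matrix is real-valued, so taking its real part loses nothing.\<close>

definition pos_def_mat :: "complex^'n^'n \<Rightarrow> bool" where
  "pos_def_mat A \<longleftrightarrow>
     hermitian_mat A \<and> (\<forall>x. x \<noteq> 0 \<longrightarrow> 0 < Re (\<Sum>i\<in>UNIV. cnj (x $ i) * (A *v x) $ i))"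

definition eigenvalue_mat :: "complex^'n^'n \<Rightarrow> complex \<Rightarrow> bool" where
  "eigenvalue_mat M \<mu> \<longleftrightarrow> (\<exists>v. v \<noteq> 0 \<and> M *v v = \<mu> *s v)"

definition real_diag_mat :: "real^'n \<Rightarrow> complex^'n^'n" where
  "real_diag_mat d = (\<chi> i j. if i = j then complex_of_real (d $ i) else 0)"

text \<open>
  The functional calculus \<open>f(A) = U diag(f(d\<^sub>1), \<dots>, f(d\<^sub>n)) U\<^sup>*\<close> of a Hermitian matrix
  \<open>A = U diag(d\<^sub>1, \<dots>, d\<^sub>n) U\<^sup>*\<close>. For Hermitian \<open>A\<close> such a unitary diagonalisation exists
  and the result does not depend on which one is chosen; for other matrices the value is unspecified.
\<close>

definition hermitian_fun :: "(real \<Rightarrow> real) \<Rightarrow> complex^'n^'n \<Rightarrow> complex^'n^'n" where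
  "hermitian_fun f A =
     (THE X. \<exists>U d. unitary_mat U \<and> A = U ** real_diag_mat d ** adjoint_mat U \<and>
                   X = U ** real_diag_mat (\<chi> i. f (d $ i)) ** adjoint_mat U)"

definition mat_powr :: "complex^'n^'n \<Rightarrow> real \<Rightarrow> complex^'n^'n" where
  "mat_powr A t = hermitian_fun (\<lambda>x. x powr t) A"

definition geometric_mean :: "real \<Rightarrow> complex^'n^'n \<Rightarrow> complex^'n^'n \<Rightarrow> complex^'n^'n" where
  "geometric_mean t A B =
     mat_powr A (1/2) ** mat_powr (mat_powr A (-1/2) ** B ** mat_powr A (-1/2)) t ** mat_powr A (1/2)"

text \<open>Only meaningful for \<open>x > 0\<close>; the value at \<open>1\<close> is the continuous extension.\<close>

definition L_pow :: "real \<Rightarrow> real \<Rightarrow> real" where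
  "L_pow t x = (if x = 1 then t else (x powr t - x powr (-t)) / (x - inverse x))"

end

theory Submission
  imports Defs
begin

text \<open>
  With \<open>C = A\<^sup>-\<^sup>1\<^sup>/\<^sup>2 B A\<^sup>-\<^sup>1\<^sup>/\<^sup>2\<close>, a positive definite matrix of determinant \<open>1\<close>, the spectrum of \<open>C\<close>
  is \<open>{x, 1/x}\<close> with \<open>x\<close> an eigenvalue of \<open>A B\<^sup>-\<^sup>1\<close>. The affine function
  \<open>s \<mapsto> L\<^bsub>1-t\<^esub>(x) + L\<^bsub>t\<^esub>(x) s\<close> interpolates \<open>s\<^sup>t\<close> at both points, so
  \<open>C\<^sup>t = L\<^bsub>1-t\<^esub>(x) I + L\<^bsub>t\<^esub>(x) C\<close>, and conjugating with \<open>A\<^sup>1\<^sup>/\<^sup>2\<close> gives the result.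
\<close>

section \<open>Adjoints and real diagonal matrices\<close>

lemma adjoint_mat_mult: "adjoint_mat (A ** B) = adjoint_mat B ** adjoint_mat A"
  by (simp add: adjoint_mat_def matrix_matrix_mult_def vec_eq_iff mult.commute)

lemma adjoint_mat_adjoint [simp]: "adjoint_mat (adjoint_mat A) = A"
  by (simp add: adjoint_mat_def vec_eq_iff)

lemma adjoint_real_diag [simp]: "adjoint_mat (real_diag_mat d) = real_diag_mat d"
  by (simp add: adjoint_mat_def real_diag_mat_def vec_eq_iff)

lemma hermitian_mat_nth: "hermitian_mat A \<Longrightarrow> cnj (A $ i $ j) = A $ j $ i"
  by (auto simp: hermitian_mat_def adjoint_mat_def vec_eq_iff)

lemma matrix_mult_real_diag: "(M ** real_diag_mat d) $ i $ j = M $ i $ j * complex_of_real (d $ j)"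
  by (simp add: matrix_matrix_mult_def real_diag_mat_def if_distrib[of "\<lambda>x. _ * x"] cong: if_cong)

lemma real_diag_matrix_mult: "(real_diag_mat d ** M) $ i $ j = complex_of_real (d $ i) * M $ i $ j"
  by (simp add: matrix_matrix_mult_def real_diag_mat_def if_distrib[of "\<lambda>x. x * _"] cong: if_cong)

lemma real_diag_mat_mult: "real_diag_mat d ** real_diag_mat e = real_diag_mat (\<chi> i. d $ i * e $ i)"
  by (simp add: vec_eq_iff matrix_mult_real_diag) (simp add: real_diag_mat_def)

lemma real_diag_mat_mult_vec: "(real_diag_mat d *v x) $ i = complex_of_real (d $ i) * x $ i"
  by (simp add: matrix_vector_mult_def real_diag_mat_def if_distrib[of "\<lambda>x. x * _"] cong: if_cong)

section \<open>Functional calculus\<close>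

text \<open>Shows that the \<open>THE\<close> is well defined and may be computed from any
  diagonalisation. If \<open>V\<close> and \<open>e\<close> give another one, then
  \<open>W = adjoint_mat V ** U\<close> intertwines the two diagonal matrices, so an entry
  \<open>W $ i $ j\<close> can be nonzero only where \<open>d $ j = e $ i\<close>. There
  \<open>f\<close> takes equal values, so \<open>W\<close> also intertwines the images under
  \<open>f\<close>.\<close>

lemma hermitian_fun_eq:
  assumes U: "unitary_mat U" and A: "A = U ** real_diag_mat d ** adjoint_mat U"
  shows "hermitian_fun f A = U ** real_diag_mat (\<chi> i. f (d $ i)) ** adjoint_mat U"
  unfolding hermitian_fun_def
proof (rule the_equality)
  show "\<exists>V e. unitary_mat V \<and> A = V ** real_diag_mat e ** adjoint_mat V \<and>
      U ** real_diag_mat (\<chi> i. f (d $ i)) ** adjoint_mat U =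
      V ** real_diag_mat (\<chi> i. f (e $ i)) ** adjoint_mat V"
    using assms by blast
next
  fix X
  assume "\<exists>V e. unitary_mat V \<and> A = V ** real_diag_mat e ** adjoint_mat V \<and>
      X = V ** real_diag_mat (\<chi> i. f (e $ i)) ** adjoint_mat V"
  then obtain V e where V: "unitary_mat V" and AV: "A = V ** real_diag_mat e ** adjoint_mat V"
    and X: "X = V ** real_diag_mat (\<chi> i. f (e $ i)) ** adjoint_mat V" by blast
  define W where "W = adjoint_mat V ** U"
  have VW: "V ** W = U" and WU: "W ** adjoint_mat U = adjoint_mat V"
    using U V by (simp_all add: W_def matrix_mul_assoc unitary_mat_def)
      (metis matrix_mul_assoc matrix_mul_rid)
  have "W ** real_diag_mat d = adjoint_mat V ** A ** U"
    using U by (metis A W_def matrix_mul_assoc matrix_mul_rid unitary_mat_def)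
  also have "\<dots> = real_diag_mat e ** W"
    using V by (metis AV W_def matrix_mul_assoc matrix_mul_lid unitary_mat_def)
  finally have "W $ i $ j * complex_of_real (d $ j) = complex_of_real (e $ i) * W $ i $ j" for i j
    by (metis matrix_mult_real_diag real_diag_matrix_mult)
  then have "W $ i $ j = 0 \<or> d $ j = e $ i" for i j
    by (metis mult.commute mult_left_cancel of_real_eq_iff)
  then have "W $ i $ j * complex_of_real (f (d $ j)) = complex_of_real (f (e $ i)) * W $ i $ j" for i j
    by (metis mult.commute mult_zero_left)
  then have "W ** real_diag_mat (\<chi> i. f (d $ i)) = real_diag_mat (\<chi> i. f (e $ i)) ** W"
    by (simp add: vec_eq_iff matrix_mult_real_diag real_diag_matrix_mult)
  then show "X = U ** real_diag_mat (\<chi> i. f (d $ i)) ** adjoint_mat U"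
    by (metis VW WU X matrix_mul_assoc)
qed

section \<open>Positive definiteness\<close>

lemma adjoint_mat_quadratic_form:
  fixes M :: "complex^'n^'n"
  shows "(\<Sum>i\<in>UNIV. cnj (x $ i) * (M *v y) $ i) = (\<Sum>i\<in>UNIV. cnj ((adjoint_mat M *v x) $ i) * y $ i)"
proof -
  have "(\<Sum>i\<in>UNIV. cnj (x $ i) * (M *v y) $ i) = (\<Sum>i\<in>UNIV. \<Sum>j\<in>UNIV. cnj (x $ i) * M $ i $ j * y $ j)"
    by (simp add: matrix_vector_mult_def sum_distrib_left mult.assoc)
  also have "\<dots> = (\<Sum>j\<in>UNIV. \<Sum>i\<in>UNIV. cnj (x $ i) * M $ i $ j * y $ j)"
    by (rule sum.swap)
  also have "\<dots> = (\<Sum>i\<in>UNIV. cnj ((adjoint_mat M *v x) $ i) * y $ i)"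
    by (simp add: matrix_vector_mult_def adjoint_mat_def sum_distrib_left sum_distrib_right mult_ac)
  finally show ?thesis .
qed

text \<open>The form of \<open>S ** B ** S\<close> at \<open>x\<close> is the form of
  \<open>B\<close> at \<open>S *v x\<close>, and the left inverse \<open>R\<close> keeps
  \<open>S *v x\<close> nonzero.\<close>

lemma pos_def_mat_congruence:
  fixes S B :: "complex^'n^'n"
  assumes B: "pos_def_mat B" and S: "hermitian_mat S" and RS: "R ** S = mat 1"
  shows "pos_def_mat (S ** B ** S)"
  unfolding pos_def_mat_def
proof (intro conjI allI impI)
  show "hermitian_mat (S ** B ** S)"
    using B S by (simp add: pos_def_mat_def hermitian_mat_def adjoint_mat_mult matrix_mul_assoc)
next
  fix x :: "complex^'n"
  assume "x \<noteq> 0"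
  moreover have "R *v (S *v x) = x"
    by (simp add: matrix_vector_mul_assoc RS)
  ultimately have "S *v x \<noteq> 0" by auto
  with B have "0 < Re (\<Sum>i\<in>UNIV. cnj ((S *v x) $ i) * (B *v (S *v x)) $ i)"
    by (auto simp: pos_def_mat_def)
  moreover have "(\<Sum>i\<in>UNIV. cnj (x $ i) * (S *v (B *v (S *v x))) $ i)
      = (\<Sum>i\<in>UNIV. cnj ((S *v x) $ i) * (B *v (S *v x)) $ i)"
    using S by (subst adjoint_mat_quadratic_form) (simp add: hermitian_mat_def)
  ultimately show "0 < Re (\<Sum>i\<in>UNIV. cnj (x $ i) * ((S ** B ** S) *v x) $ i)"
    by (simp add: matrix_vector_mul_assoc matrix_mul_assoc)
qed

text \<open>The quadratic form of \<open>A\<close> at the \<open>k\<close>-th column of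
  \<open>U\<close> equals \<open>d $ k\<close>.\<close>

lemma pos_def_mat_eigenvalues_pos:
  fixes U :: "complex^'n^'n"
  assumes A: "pos_def_mat A" and U: "unitary_mat U"
    and AU: "A = U ** real_diag_mat d ** adjoint_mat U"
  shows "0 < d $ k"
proof -
  define x where "x = U *v axis k 1"
  have Ux: "adjoint_mat U *v x = axis k 1"
    using U by (simp add: x_def matrix_vector_mul_assoc unitary_mat_def)
  then have "x \<noteq> 0" by (metis axis_eq_0_iff matrix_vector_mult_0_right zero_neq_one)
  then have "0 < Re (\<Sum>i\<in>UNIV. cnj (x $ i) * (A *v x) $ i)"
    using A by (simp add: pos_def_mat_def)
  also have "A *v x = U *v (real_diag_mat d *v axis k 1)"
    by (simp add: AU Ux flip: matrix_vector_mul_assoc)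
  also have "(\<Sum>i\<in>UNIV. cnj (x $ i) * (U *v (real_diag_mat d *v axis k 1)) $ i) = complex_of_real (d $ k)"
    by (subst adjoint_mat_quadratic_form)
      (simp add: Ux real_diag_mat_mult_vec axis_def if_distrib if_distribR cong: if_cong)
  finally show ?thesis by simp
qed

lemma unitary_conj_mult:
  fixes U :: "complex^'n^'n"
  assumes "unitary_mat U"
  shows "(U ** real_diag_mat d ** adjoint_mat U) ** (U ** real_diag_mat e ** adjoint_mat U)
    = U ** real_diag_mat (\<chi> i. d $ i * e $ i) ** adjoint_mat U"
proof -
  have "(U ** real_diag_mat d ** adjoint_mat U) ** (U ** real_diag_mat e ** adjoint_mat U)
      = U ** real_diag_mat d ** (adjoint_mat U ** U) ** real_diag_mat e ** adjoint_mat U"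
    by (simp only: matrix_mul_assoc)
  also have "\<dots> = U ** (real_diag_mat d ** real_diag_mat e) ** adjoint_mat U"
    using assms by (simp add: unitary_mat_def matrix_mul_assoc)
  finally show ?thesis by (simp only: real_diag_mat_mult)
qed

section \<open>Unitary diagonalisation of 2 x 2 Hermitian matrices\<close>

text \<open>If the off-diagonal entry \<open>b\<close> vanishes, the first basis vector works.
  Otherwise, for a root \<open>l\<close> of the characteristic polynomial, \<open>(b, l - a)\<close>
  is an eigenvector; it is nonzero because \<open>b\<close> is, so it can be normalised.\<close>

lemma exists_unit_eigenvector_2:
  fixes A :: "complex^2^2"
  assumes "hermitian_mat A"
  obtains p q l :: complex where "cnj p * p + cnj q * q = 1"
    "A $ 1 $ 1 * p + A $ 1 $ 2 * q = l * p" "A $ 2 $ 1 * p + A $ 2 $ 2 * q = l * q"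
proof (cases "A $ 1 $ 2 = 0")
  case True
  then have "A $ 2 $ 1 = 0"
    using hermitian_mat_nth[OF assms, of 1 2] by simp
  then show ?thesis using that[of 1 0 "A $ 1 $ 1"] by simp
next
  case False
  define a b c where "a = A $ 1 $ 1" and "b = A $ 1 $ 2" and "c = A $ 2 $ 2"
  have A21: "A $ 2 $ 1 = cnj b"
    using hermitian_mat_nth[OF assms, of 1 2] by (simp add: b_def)
  \<comment> \<open>Half a square root of the discriminant of the characteristic polynomial, so that
    \<open>l\<close> below is one of its roots.\<close>
  define s where "s = csqrt (((a - c) / 2)\<^sup>2 + b * cnj b)"
  define l where "l = (a + c) / 2 + s"
  define n where "n = complex_of_real (sqrt ((cmod b)\<^sup>2 + (cmod (l - a))\<^sup>2))"
  have "s\<^sup>2 = ((a - c) / 2)\<^sup>2 + b * cnj b"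
    by (simp add: s_def)
  moreover have "l - a = s - (a - c) / 2" "l - c = s + (a - c) / 2"
    by (simp_all add: l_def field_simps)
  then have "(l - a) * (l - c) = s\<^sup>2 - ((a - c) / 2)\<^sup>2"
    by (simp only: power2_eq_square square_diff_square_factored mult.commute)
  \<comment> \<open>The characteristic equation \<open>(l - a) * (l - c) = b * cnj b\<close>,
    arranged as the second row of the eigenvector equation.\<close>
  ultimately have char: "cnj b * b + c * (l - a) = l * (l - a)"
    by (simp add: algebra_simps)
  have pos: "(cmod b)\<^sup>2 + (cmod (l - a))\<^sup>2 > 0"
    using False by (simp add: b_def add_pos_nonneg)
  then have n0: "n \<noteq> 0"
    unfolding n_def of_real_eq_0_iff real_sqrt_eq_0_iff by linarith
  have "n * n = complex_of_real ((cmod b)\<^sup>2 + (cmod (l - a))\<^sup>2)"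
    using pos by (simp add: n_def del: of_real_add flip: of_real_mult)
  then have n2: "n * n = cnj b * b + cnj (l - a) * (l - a)"
    by (simp only: of_real_add complex_norm_square mult.commute[of "cnj _"])
  have "cnj n = n"
    by (simp add: n_def)
  show ?thesis
  proof (rule that[of "b / n" "(l - a) / n" l])
    show "cnj (b / n) * (b / n) + cnj ((l - a) / n) * ((l - a) / n) = 1"
      using n0 by (simp add: \<open>cnj n = n\<close> n2[symmetric] add_divide_distrib[symmetric] del: complex_cnj_diff)
    show "A $ 1 $ 1 * (b / n) + A $ 1 $ 2 * ((l - a) / n) = l * (b / n)"
      using n0 by (simp add: a_def[symmetric] b_def[symmetric] field_simps)
    show "A $ 2 $ 1 * (b / n) + A $ 2 $ 2 * ((l - a) / n) = l * ((l - a) / n)"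
      using n0 char by (simp add: A21 c_def[symmetric] add_divide_distrib[symmetric])
  qed
qed

lemma hermitian_mat_diagonalisation_2:
  fixes A :: "complex^2^2"
  assumes A: "hermitian_mat A"
  obtains U d where "unitary_mat U" "A = U ** real_diag_mat d ** adjoint_mat U"
proof -
  obtain p q l where unit: "cnj p * p + cnj q * q = 1"
    and e1: "A $ 1 $ 1 * p + A $ 1 $ 2 * q = l * p" and e2: "A $ 2 $ 1 * p + A $ 2 $ 2 * q = l * q"
    using exists_unit_eigenvector_2[OF A] by metis
  \<comment> \<open>The second column is the unit vector orthogonal to the eigenvector
    \<open>(p, q)\<close>.\<close>
  define U :: "complex^2^2" where "U = vector [vector [p, - cnj q], vector [q, cnj p]]"
  have U: "unitary_mat U"
    using unit by (simp add: U_def unitary_mat_def adjoint_mat_def vec_eq_iff forall_2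
        matrix_matrix_mult_def sum_2 mat_def algebra_simps)
  define M where "M = adjoint_mat U ** A ** U"
  have M: "hermitian_mat M"
    using A by (simp add: M_def adjoint_mat_mult matrix_mul_assoc hermitian_mat_def)
  have "(A ** U) $ 1 $ 1 = l * p" "(A ** U) $ 2 $ 1 = l * q"
    using e1 e2 by (simp_all add: U_def matrix_matrix_mult_def sum_2)
  \<comment> \<open>This entry pairs the second column of \<open>U\<close> with the first column of
    \<open>A ** U\<close>, which is \<open>l\<close> times the first column of \<open>U\<close>;
    orthogonality makes it vanish. The entry opposite then vanishes since \<open>M\<close> is
    Hermitian.\<close>
  moreover have "M $ 2 $ 1 = cnj (U $ 1 $ 2) * (A ** U) $ 1 $ 1 + cnj (U $ 2 $ 2) * (A ** U) $ 2 $ 1"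
    unfolding M_def matrix_mul_assoc[symmetric] matrix_matrix_mult_def[of "adjoint_mat U" "A ** U"]
    by (simp add: sum_2 adjoint_mat_def)
  ultimately have M21: "M $ 2 $ 1 = 0"
    by (simp add: U_def)
  note cnj_M = hermitian_mat_nth[OF M]
  have M12: "M $ 1 $ 2 = 0"
    using cnj_M[of 2 1] M21 by simp
  have "complex_of_real (Re (M $ i $ i)) = M $ i $ i" for i
    using cnj_M[of i i] by (simp add: complex_eq_iff)
  then have "M = real_diag_mat (\<chi> i. Re (M $ i $ i))"
    using M21 M12 by (simp add: vec_eq_iff forall_2 real_diag_mat_def)
  then obtain d where "M = real_diag_mat d" ..
  moreover have "A = U ** M ** adjoint_mat U"
    using U unfolding M_def unitary_mat_def
    by (metis matrix_mul_assoc matrix_mul_lid matrix_mul_rid)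
  ultimately show ?thesis using that[OF U] by blast
qed

section \<open>Powers of a positive definite matrix\<close>

lemma matrix_add_rdistrib: "(A + B) ** C = A ** C + B ** C"
  by (simp add: matrix_matrix_mult_def vec_eq_iff distrib_right sum.distrib)

text \<open>Carries an affine expression in \<open>M\<close> through the unitary conjugation by
  \<open>V\<close> and the congruence by \<open>R\<close> in the main proof.\<close>

lemma matrix_affine_mult:
  fixes P :: "'a::real_algebra_1^'n^'m" and Q :: "'a^'k^'n"
  shows "P ** (a *\<^sub>R mat 1 + b *\<^sub>R M) ** Q = a *\<^sub>R (P ** Q) + b *\<^sub>R (P ** M ** Q)"
  by (simp add: matrix_add_ldistrib matrix_add_rdistrib matrix_scalar_ac scalar_matrix_assoc[symmetric])

text \<open>In a fixed diagonalisation all powers of \<open>A\<close> are diagonal, so exponents add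
  under multiplication; the products reduce to the powers 1 and 0.\<close>

lemma mat_powr_half:
  fixes A :: "complex^2^2"
  assumes A: "pos_def_mat A"
  shows "mat_powr A (1/2) ** mat_powr A (1/2) = A"
    and "mat_powr A (1/2) ** mat_powr A (-1/2) = mat 1"
    and "mat_powr A (-1/2) ** mat_powr A (1/2) = mat 1"
    and "hermitian_mat (mat_powr A (-1/2))"
proof -
  obtain U d where U: "unitary_mat U" and AU: "A = U ** real_diag_mat d ** adjoint_mat U"
    using hermitian_mat_diagonalisation_2 A unfolding pos_def_mat_def by metis
  have powr: "mat_powr A t = U ** real_diag_mat (\<chi> i. d $ i powr t) ** adjoint_mat U" for t
    unfolding mat_powr_def by (rule hermitian_fun_eq[OF U AU])
  have mult: "mat_powr A s ** mat_powr A t = mat_powr A (s + t)" for s t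
    unfolding powr unitary_conj_mult[OF U] by (simp add: powr_add)
  have pos: "0 < d $ i" for i
    by (rule pos_def_mat_eigenvalues_pos[OF A U AU])
  have "mat_powr A 1 = A"
    unfolding powr using pos by (simp add: AU less_imp_le)
  then show "mat_powr A (1/2) ** mat_powr A (1/2) = A" by (simp add: mult)
  \<comment> \<open>Positivity of the eigenvalues matters here, since \<open>0 powr 0\<close> is
    \<open>0\<close>.\<close>
  have "real_diag_mat (\<chi> i. d $ i powr 0) = (mat 1 :: complex^2^2)"
    using pos less_irrefl by (auto simp: real_diag_mat_def mat_def vec_eq_iff) (metis less_irrefl)
  then have "mat_powr A 0 = mat 1"
    unfolding powr using U by (simp add: unitary_mat_def)
  then show "mat_powr A (1/2) ** mat_powr A (-1/2) = mat 1"
    and "mat_powr A (-1/2) ** mat_powr A (1/2) = mat 1"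
    by (simp_all add: mult)
  show "hermitian_mat (mat_powr A (-1/2))"
    by (simp add: powr hermitian_mat_def adjoint_mat_mult matrix_mul_assoc)
qed

lemma invertible_matrix_inv_right:
  fixes A :: "'a::semiring_1^'n^'m"
  assumes "invertible A"
  shows "A ** matrix_inv A = mat 1"
  using someI_ex[OF assms[unfolded invertible_def]] by (simp add: matrix_inv_def)

text \<open>For \<open>x \<noteq> 1\<close>, multiplying by \<open>x - inverse x\<close> leaves an
  algebraic identity at each of the two nodes. At \<open>x = 1\<close> the nodes coincide and the
  claim is \<open>1 = (1 - t) + t\<close>.\<close>

lemma L_pow_interpolation:
  assumes x: "x > 0" and s: "s = x \<or> s = inverse x"
  shows "s powr t = L_pow (1 - t) x + L_pow t x * s"
proof (cases "x = 1")
  case True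
  then show ?thesis using s by (auto simp: L_pow_def)
next
  case False
  have "x\<^sup>2 \<noteq> 1"
    using x False by (auto simp: power2_eq_1_iff)
  then have "x - inverse x \<noteq> 0"
    using x by (simp add: field_simps power2_eq_square)
  moreover have "x powr (1 - t) = x * inverse (x powr t)" "x powr (- (1 - t)) = x powr t * inverse x"
    "x powr (- t) = inverse (x powr t)"
    using x by (simp_all add: powr_diff powr_minus divide_inverse)
  then have "L_pow (1 - t) x + L_pow t x * s
      = (x * inverse (x powr t) - x powr t * inverse x + (x powr t - inverse (x powr t)) * s) / (x - inverse x)"
    using False by (simp add: L_pow_def add_divide_distrib)
  moreover have "x * inverse (x powr t) - x powr t * inverse x + (x powr t - inverse (x powr t)) * s
      = s powr t * (x - inverse x)"
    using s
  proof
    assume "s = x"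
    then show ?thesis by (simp add: algebra_simps)
  next
    assume "s = inverse x"
    moreover have "inverse x powr t = inverse (x powr t)"
      using x by (simp add: inverse_powr)
    ultimately show ?thesis by (simp add: algebra_simps)
  qed
  ultimately show ?thesis by simp
qed

section \<open>The geometric mean of two matrices of determinant one\<close>

theorem lemma5p1:
  fixes A B :: "complex^2^2" and t :: real and \<mu> :: complex
  assumes "pos_def_mat A" and "pos_def_mat B"
    and "det A = 1" and "det B = 1"
    and "t \<in> {0..1}"
    and "eigenvalue_mat (A ** matrix_inv B) \<mu>"
  shows "\<exists>x>0. \<mu> = complex_of_real x \<and>
           geometric_mean t A B = L_pow (1 - t) x *\<^sub>R A + L_pow t x *\<^sub>R B"
proof -
  define R S where "R = mat_powr A (1/2)" and "S = mat_powr A (-1/2)"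
  have RR: "R ** R = A" and RS: "R ** S = mat 1" and SR: "S ** R = mat 1" and S: "hermitian_mat S"
    using mat_powr_half[OF \<open>pos_def_mat A\<close>] by (simp_all add: R_def S_def)
  define C where "C = S ** B ** S"
  have C: "pos_def_mat C"
    unfolding C_def by (rule pos_def_mat_congruence[OF \<open>pos_def_mat B\<close> S RS])
  have RCR: "R ** C ** R = B"
    unfolding C_def by (metis RS SR matrix_mul_assoc matrix_mul_lid matrix_mul_rid)
  have "det R * det R = 1"
    using RR \<open>det A = 1\<close> by (metis det_mul)
  moreover have "det R * det C * det R = 1"
    using RCR \<open>det B = 1\<close> by (metis det_mul)
  ultimately have det_C: "det C = 1" by (simp add: mult_ac)
  obtain V e where V: "unitary_mat V" and CV: "C = V ** real_diag_mat e ** adjoint_mat V"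
    using hermitian_mat_diagonalisation_2 C unfolding pos_def_mat_def by metis
  have e_pos: "0 < e $ i" for i
    by (rule pos_def_mat_eigenvalues_pos[OF C V CV])
  have "det V * det (adjoint_mat V) = 1"
    using V by (metis det_I det_mul unitary_mat_def)
  moreover have "(det V * det (adjoint_mat V)) * det (real_diag_mat e) = 1"
    using det_C by (simp add: CV det_mul mult_ac)
  ultimately have "det (real_diag_mat e) = 1" by simp
  then have e12: "e $ 1 * e $ 2 = 1"
    by (simp add: det_2 real_diag_mat_def flip: of_real_mult)

  obtain v where "v \<noteq> 0" and v: "(A ** matrix_inv B) *v v = \<mu> *s v"
    using assms(6) by (auto simp: eigenvalue_mat_def)
  have B_inv: "B ** matrix_inv B = mat 1"
    using \<open>det B = 1\<close> by (simp add: invertible_det_nz invertible_matrix_inv_right)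
  \<comment> \<open>Passing to \<open>w\<close> removes the inverse: the eigenvalue equation becomes
    the generalised problem \<open>A *v w = \<mu> *s (B *v w)\<close>.\<close>
  define w where "w = matrix_inv B *v v"
  have Bw: "B *v w = v"
    by (simp add: w_def matrix_vector_mul_assoc B_inv)
  have Aw: "A *v w = \<mu> *s (B *v w)"
    using v Bw by (simp add: w_def matrix_vector_mul_assoc)
  \<comment> \<open>The coordinates of \<open>R *v w\<close> in the eigenbasis of
    \<open>C\<close>.\<close>
  define z where "z = adjoint_mat V *v (R *v w)"
  have Vz: "V *v z = R *v w"
    using V by (simp add: z_def matrix_vector_mul_assoc matrix_mul_assoc unitary_mat_def)
  then have "S *v (V *v z) = w"
    by (simp add: matrix_vector_mul_assoc SR)
  then have "z \<noteq> 0"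
    using Bw \<open>v \<noteq> 0\<close> by auto
  then obtain k where k: "z $ k \<noteq> 0"
    by (auto simp: vec_eq_iff)
  \<comment> \<open>Multiplying the generalised problem by \<open>S\<close> turns it into
    \<open>R *v w = \<mu> *s (C *v (R *v w))\<close>, so \<open>\<mu>\<close> is the reciprocal of
    an eigenvalue of \<open>C\<close>; a nonzero coordinate of \<open>z\<close> tells which
    one.\<close>
  have "R *v w = S *v (A *v w)"
    unfolding RR[symmetric] by (metis SR matrix_mul_assoc matrix_mul_lid matrix_vector_mul_assoc)
  also have "\<dots> = \<mu> *s (S *v (B *v w))"
    by (simp add: Aw vector_scalar_commute)
  also have "S *v (B *v w) = C *v (R *v w)"
    unfolding C_def by (metis SR matrix_mul_assoc matrix_mul_rid matrix_vector_mul_assoc)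
  also have "\<dots> = V *v (real_diag_mat e *v z)"
    by (simp add: CV z_def matrix_vector_mul_assoc matrix_mul_assoc)
  finally have "z = adjoint_mat V *v (\<mu> *s (V *v (real_diag_mat e *v z)))"
    by (simp add: z_def)
  also have "\<dots> = \<mu> *s (real_diag_mat e *v z)"
    using V by (simp add: vector_scalar_commute[symmetric] matrix_vector_mul_assoc matrix_mul_assoc unitary_mat_def)
  finally have "z $ k = (\<mu> *s (real_diag_mat e *v z)) $ k" by simp
  then have "\<mu> * complex_of_real (e $ k) = 1"
    using k by (simp add: real_diag_mat_mult_vec)
  then have \<mu>: "\<mu> = complex_of_real (inverse (e $ k))"
    using e_pos[of k] by (simp add: field_simps)

  define x where "x = inverse (e $ k)"
  have x: "x > 0" using e_pos by (simp add: x_def)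
  have "inverse (e $ 1) = e $ 2" "inverse (e $ 2) = e $ 1"
    using e12 by (auto intro: inverse_unique simp: mult.commute)
  \<comment> \<open>The eigenvalues of \<open>C\<close> are reciprocal to each other, so they are
    \<open>x\<close> and \<open>inverse x\<close> whichever index \<open>k\<close> is.\<close>
  then have "e $ i = x \<or> e $ i = inverse x" for i
    unfolding x_def using exhaust_2[of i] exhaust_2[of k] by auto
  then have e_powr: "e $ i powr t = L_pow (1 - t) x + L_pow t x * e $ i" for i
    using L_pow_interpolation[OF x] by blast
  have "mat_powr C t = V ** real_diag_mat (\<chi> i. e $ i powr t) ** adjoint_mat V"
    unfolding mat_powr_def by (rule hermitian_fun_eq[OF V CV])
  also have "real_diag_mat (\<chi> i. e $ i powr t) = L_pow (1 - t) x *\<^sub>R mat 1 + L_pow t x *\<^sub>R real_diag_mat e"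
    by (simp add: e_powr real_diag_mat_def mat_def vec_eq_iff complex_eq_iff)
  also have "V ** \<dots> ** adjoint_mat V = L_pow (1 - t) x *\<^sub>R mat 1 + L_pow t x *\<^sub>R C"
    using V by (simp add: CV matrix_affine_mult unitary_mat_def)
  finally have "geometric_mean t A B = R ** (L_pow (1 - t) x *\<^sub>R mat 1 + L_pow t x *\<^sub>R C) ** R"
    by (simp add: geometric_mean_def R_def S_def C_def)
  also have "\<dots> = L_pow (1 - t) x *\<^sub>R A + L_pow t x *\<^sub>R B"
    by (simp add: matrix_affine_mult RR RCR)
  finally show ?thesis
    using x \<mu> x_def by blast
qed

end
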